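(* Fundamental line complexes in $\mathbb{CP}^3$ are (in general position) precisely the line complexes with the property that neighbouring lines intersect and opposite lines of any elementary cube are interchanged by a correlation which, necessarily, constitutes a polarity. That is, a line complex $\mathsf{l}:\mathbb{Z}^3\to\{\text{lines in }\mathbb{CP}^3\}$ is fundamental if and only if any neighbouring lines intersect and, for any elementary cube, there exists a correlation of $\mathbb{CP}^3$ which interchanges the lines attached to any two opposite vertices of the cube; any such correlation is a polarity. Furthermore, the coplanarity and concurrency properties associated with any elementary cube of a fundamental line complex are interchanged by the corresponding correlation in the sense that any four coplanar diagonals are mapped to four concurrent diagonals and vice versa.
   Context: Notation: for a function $f$ on $\mathbb{Z}^3$ the argument is suppressed, and lower indices denote unit shifts: $f=f(n_1,n_2,n_3)$, $f_1=f(n_1+1,n_2,n_3)$, $f_{23}=f(n_1,n_2+1,n_3+1)$, etc. A line complex in $\mathbb{CP}^3$ is a map $\mathsf{l}:\mathbb{Z}^3\to\{\text{lines in }\mathbb{CP}^3\}$; neighbouring lines are $\mathsf{l}$ and $\mathsf{l}_l$, $l\in\{1,2,3\}$. An elementary cube consists of the eight lines $\mathsf{l},\mathsf{l}_1,\mathsf{l}_2,\mathsf{l}_3,\mathsf{l}_{12},\mathsf{l}_{13},\mathsf{l}_{23},\mathsf{l}_{123}$ (based at any point of $\mathbb{Z}^3$); its pairs of opposite lines are $(\mathsf{l},\mathsf{l}_{123})$, $(\mathsf{l}_1,\mathsf{l}_{23})$, $(\mathsf{l}_2,\mathsf{l}_{13})$, $(\mathsf{l}_3,\mathsf{l}_{12})$.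 Fundamental line complex in $\mathbb{CP}^3$: a line complex such that any neighbouring lines intersect and the points of intersection $\mathsf{p}^l=\mathsf{l}\cap\mathsf{l}_l$ enjoy the coplanarity (planarity) property: for any distinct $l,m,p\in\{1,2,3\}$, the four points $\mathsf{p}^l,\mathsf{p}^l_m,\mathsf{p}^l_{mp},\mathsf{p}^l_p$ are coplanar. Generically, this is equivalent to the concurrency property: for any distinct $l,m,p$, the four lines connecting the points $\mathsf{p}^l,\mathsf{p}^p,\mathsf{p}^l_p,\mathsf{p}^p_l$ with their shifted counterparts $\mathsf{p}^l_m,\mathsf{p}^p_m,\mathsf{p}^l_{pm},\mathsf{p}^p_{lm}$, respectively, are concurrent. Diagonals: for distinct $l,m$, the diagonal $\mathsf{l}^{l,m}$ is the line through $\mathsf{p}^l$ and $\mathsf{p}^l_m$; with $p$ denoting the third index, $\mathsf{l}^{l,m}_p$ is the line through $\mathsf{p}^l_p$ and $\mathsf{p}^l_{mp}$. An elementary cube has the 12 diagonals $\mathsf{l}^{l,m},\mathsf{l}^{l,m}_p$. With $\{l,m,p\}=\{1,2,3\}$, the quadruples of coplanar diagonals are $\{\mathsf{l}^{l,m},\mathsf{l}^{l,m}_p,\mathsf{l}^{l,p},\mathsf{l}^{l,p}_m\}$ (one for each $l$), and the quadruples of concurrent diagonals are $\{\mathsf{l}^{l,m},\mathsf{l}^{l,m}_p,\mathsf{l}^{p,m},\mathsf{l}^{p,m}_l\}$ (one for each $m$). Correlation of $\mathbb{CP}^3$: an incidence-preserving transformation mapping $k$-dimensional projective subspaces to $(2-k)$-dimensional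 ones, encoded in an invertible complex $4\times4$ matrix $\mathsf{B}$ such that a point with homogeneous coordinates $\mathsf{x}$ is mapped to the plane $\kappa(\mathsf{x})=\{\mathsf{y}\in\mathbb{C}^4:\mathsf{y}^T\mathsf{B}\mathsf{x}=0\}$; the points of a line are mapped to planes which meet in a line, which is the image of that line. A polarity is a correlation whose matrix $\mathsf{B}$ is symmetric (equivalently, it is the polarity with respect to the quadric $\mathsf{x}^T\mathsf{B}\mathsf{x}=0$). Standing genericity: line complexes are assumed to be in general position subject to the required incidences. In particular, neighbouring lines are distinct, the points of intersection on a given line of an elementary cube attached to different edges are distinct, and any spatial hexagon formed by six lines of an elementary cube obtained by omitting two opposite lines is in general position (its six vertices are in general position in $\mathbb{CP}^3$, i.e. no four of them are coplanar). *)

theory Defs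
  imports "HOL-Analysis.Analysis"
begin

text \<open>
  A projective subspace of \<open>CP\<^sup>3\<close> is the corresponding complex linear subspace of \<open>\<complex>\<^sup>4\<close>, so that
  intersections of projective subspaces are plain intersections of sets (the empty projective
  subspace being \<open>{0}\<close>).
\<close>

definition proj_subspace :: "nat \<Rightarrow> (complex^4) set \<Rightarrow> bool" where
  "proj_subspace k S \<longleftrightarrow> vec.subspace S \<and> vec.dim S = k + 1"

abbreviation proj_point :: "(complex^4) set \<Rightarrow> bool" where
  "proj_point \<equiv> proj_subspace 0"

abbreviation proj_line :: "(complex^4) set \<Rightarrow> bool" where
  "proj_line \<equiv> proj_subspace 1"

abbreviation proj_plane :: "(complex^4) set \<Rightarrow> bool" where
  "proj_plane \<equiv> proj_subspace 2"

definition proj_intersect :: "(complex^4) set \<Rightarrow> (complex^4) set \<Rightarrow> bool" where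
  "proj_intersect L M \<longleftrightarrow> (\<exists>P. proj_point P \<and> P \<subseteq> L \<inter> M)"

definition proj_join :: "(complex^4) set \<Rightarrow> (complex^4) set \<Rightarrow> (complex^4) set" where
  "proj_join P Q = vec.span (P \<union> Q)"

text \<open>Used both for families of points and for families of lines.\<close>

definition proj_coplanar :: "(complex^4) set set \<Rightarrow> bool" where
  "proj_coplanar \<S> \<longleftrightarrow> (\<exists>E. proj_plane E \<and> (\<forall>S\<in>\<S>. S \<subseteq> E))"

definition proj_concurrent :: "(complex^4) set set \<Rightarrow> bool" where
  "proj_concurrent \<L> \<longleftrightarrow> (\<exists>P. proj_point P \<and> (\<forall>L\<in>\<L>. P \<subseteq> L))"

text \<open>
  Lattice directions are the elements of the three-element type \<open>3\<close>; \<open>n + dir i\<close> is the unit shift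
  of \<open>n\<close> in direction \<open>i\<close>, so \<open>l (n + dir i + dir j)\<close> is what is usually written \<open>l\<^sub>i\<^sub>j\<close>.
\<close>

abbreviation dir :: "3 \<Rightarrow> int^3" where
  "dir i \<equiv> axis i 1"

definition line_complex :: "(int^3 \<Rightarrow> (complex^4) set) \<Rightarrow> bool" where
  "line_complex l \<longleftrightarrow> (\<forall>n. proj_line (l n))"

definition neighbours_intersect :: "(int^3 \<Rightarrow> (complex^4) set) \<Rightarrow> bool" where
  "neighbours_intersect l \<longleftrightarrow> (\<forall>n i. proj_intersect (l n) (l (n + dir i)))"

definition meet_point :: "(int^3 \<Rightarrow> (complex^4) set) \<Rightarrow> 3 \<Rightarrow> int^3 \<Rightarrow> (complex^4) set" where
  "meet_point l i n = l n \<inter> l (n + dir i)"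

definition fundamental :: "(int^3 \<Rightarrow> (complex^4) set) \<Rightarrow> bool" where
  "fundamental l \<longleftrightarrow> neighbours_intersect l \<and>
     (\<forall>n i j k. distinct [i, j, k] \<longrightarrow>
        proj_coplanar {meet_point l i n, meet_point l i (n + dir j),
                       meet_point l i (n + dir j + dir k), meet_point l i (n + dir k)})"

text \<open>
  The vertices of the elementary cube based at \<open>n\<close> are labelled by the subsets of the set of
  directions; opposite vertices have complementary labels.  The edge joining the vertices \<open>S\<close>
  and \<open>insert i S\<close>, where \<open>i \<notin> S\<close>, is labelled by \<open>(S, i)\<close>.
\<close>

definition cube_vertex :: "int^3 \<Rightarrow> 3 set \<Rightarrow> int^3" where
  "cube_vertex n S = n + (\<Sum>i\<in>S. dir i)"

definition cube_edges :: "(3 set \<times> 3) set" where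
  "cube_edges = {(S, i). i \<notin> S}"

definition edge_ends :: "3 set \<times> 3 \<Rightarrow> 3 set set" where
  "edge_ends = (\<lambda>(S, i). {S, insert i S})"

definition edge_point ::
    "(int^3 \<Rightarrow> (complex^4) set) \<Rightarrow> int^3 \<Rightarrow> 3 set \<times> 3 \<Rightarrow> (complex^4) set" where
  "edge_point l n = (\<lambda>(S, i). meet_point l i (cube_vertex n S))"

text \<open>
  The six edges avoiding the opposite vertices \<open>S\<close> and \<open>-S\<close>; the points attached to them are the
  vertices of the spatial hexagon obtained by omitting the lines attached to \<open>S\<close> and \<open>-S\<close>.
\<close>

definition hexagon_edges :: "3 set \<Rightarrow> (3 set \<times> 3) set" where
  "hexagon_edges S = {d \<in> cube_edges. edge_ends d \<inter> {S, - S} = {}}"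

text \<open>
  General position is understood subject to the required incidences: the conditions on the points
  of intersection are imposed only if neighbouring lines intersect.  Otherwise they would force
  neighbouring lines to intersect.
\<close>

definition general_position :: "(int^3 \<Rightarrow> (complex^4) set) \<Rightarrow> bool" where
  "general_position l \<longleftrightarrow>
     (\<forall>n i. l n \<noteq> l (n + dir i)) \<and>
     (neighbours_intersect l \<longrightarrow>
        (\<forall>n S. \<forall>d\<in>cube_edges. \<forall>d'\<in>cube_edges.
           S \<in> edge_ends d \<and> S \<in> edge_ends d' \<and> d \<noteq> d' \<longrightarrow>
           edge_point l n d \<noteq> edge_point l n d') \<and>
        (\<forall>n S. \<forall>D\<subseteq>hexagon_edges S.
           card D = 4 \<longrightarrow> \<not> proj_coplanar (edge_point l n ` D)))"

text \<open>
  A correlation is given by an invertible matrix \<open>B\<close>; \<open>correlation_plane B x\<close> is the set of all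
  \<open>y\<close> with \<open>y\<^sup>T B x = 0\<close>.
\<close>

definition correlation :: "complex^4^4 \<Rightarrow> bool" where
  "correlation B \<longleftrightarrow> invertible B"

definition polarity :: "complex^4^4 \<Rightarrow> bool" where
  "polarity B \<longleftrightarrow> correlation B \<and> transpose B = B"

definition correlation_plane :: "complex^4^4 \<Rightarrow> complex^4 \<Rightarrow> (complex^4) set" where
  "correlation_plane B x = {y. (\<Sum>i\<in>UNIV. y $ i * (B *v x) $ i) = 0}"

definition correlation_image :: "complex^4^4 \<Rightarrow> (complex^4) set \<Rightarrow> (complex^4) set" where
  "correlation_image B L = (\<Inter>x\<in>L. correlation_plane B x)"

definition interchanges_opposite ::
    "complex^4^4 \<Rightarrow> (int^3 \<Rightarrow> (complex^4) set) \<Rightarrow> int^3 \<Rightarrow> bool" where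
  "interchanges_opposite B l n \<longleftrightarrow>
     (\<forall>S. correlation_image B (l (cube_vertex n S)) = l (cube_vertex n (- S)))"

text \<open>
  With \<open>{i, j, k}\<close> the set of all directions, the diagonals \<open>l\<^sup>i\<^sup>j\<close> and \<open>l\<^sup>i\<^sup>j\<^sub>k\<close> of the cube based at
  \<open>n\<close> are \<open>diagonal l i j n\<close> and \<open>diagonal l i j (n + dir k)\<close>.
\<close>

definition diagonal ::
    "(int^3 \<Rightarrow> (complex^4) set) \<Rightarrow> 3 \<Rightarrow> 3 \<Rightarrow> int^3 \<Rightarrow> (complex^4) set" where
  "diagonal l i j n = proj_join (meet_point l i n) (meet_point l i (n + dir j))"

definition coplanar_quadruples ::
    "(int^3 \<Rightarrow> (complex^4) set) \<Rightarrow> int^3 \<Rightarrow> (complex^4) set set set" where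
  "coplanar_quadruples l n =
     {{diagonal l i j n, diagonal l i j (n + dir k), diagonal l i k n, diagonal l i k (n + dir j)}
       | i j k. distinct [i, j, k]}"

definition concurrent_quadruples ::
    "(int^3 \<Rightarrow> (complex^4) set) \<Rightarrow> int^3 \<Rightarrow> (complex^4) set set set" where
  "concurrent_quadruples l n =
     {{diagonal l i j n, diagonal l i j (n + dir k), diagonal l k j n, diagonal l k j (n + dir i)}
       | i j k. distinct [i, j, k]}"

end

theory Submission
  imports Defs
begin

text \<open>
  Omit two opposite lines from an elementary cube. The remaining six lines are the sides of a spatial
  hexagon, and the lines attached to opposite vertices of the cube are opposite sides of the hexagon.
  A correlation interchanges opposite sides if and only if its bilinear form vanishes on all pairs
  of non-adjacent vertices. For a hexagon in general position such a form is automatically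
  symmetric (\<open>conjugate_nonadjacent_symmetric\<close>), and a non-degenerate one always
  exists (\<open>polarity_of_hexagon\<close>). So every cube comes with a polarity that interchanges three of the four
  pairs of opposite lines, and the question is what it does to the fourth pair.

  Each of the two omitted lines is a transversal of three alternate sides. The planarity condition in a
  given direction involves one edge point on each of the two omitted lines and two vertices of the
  hexagon. It holds if and only if the edge point on the second line is conjugate to every
  point of the first line (\<open>transversal_conjugate_iff\<close>). As the second line is spanned by its edge
  points, the three planarity conditions together say that the polarity maps the first line to the
  second one (\<open>planar_cube_iff\<close>).

  Finally, conjugacy of points on opposite lines shows that the correlation maps each diagonal to
  the diagonal on the opposite face of the cube with the two directions
  exchanged (\<open>correlation_image_diagonal\<close>). This turns quadruples in a common plane into quadruples through
  a common point, namely the image of the plane, and conversely.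
\<close>

section \<open>Correlations as bilinear forms\<close>

text \<open>
  The bilinear form whose vanishing expresses that the point of \<open>y\<close> lies on the plane assigned to the
  point of \<open>x\<close>. The coordinate sum is bilinear; no complex conjugation is involved.
\<close>

definition corr_form :: "complex^4^4 \<Rightarrow> complex^4 \<Rightarrow> complex^4 \<Rightarrow> complex" where
  "corr_form B y x = (\<Sum>i\<in>UNIV. y $ i * (B *v x) $ i)"

lemma corr_form_linear [simp]:
  "corr_form B (y + z) x = corr_form B y x + corr_form B z x"
  "corr_form B y (x + z) = corr_form B y x + corr_form B y z"
  "corr_form B (c *s y) x = c * corr_form B y x"
  "corr_form B y (c *s x) = c * corr_form B y x"
  "corr_form B 0 x = 0"
  "corr_form B y 0 = 0"
  "corr_form B (- y) x = - corr_form B y x"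
  "corr_form B y (- x) = - corr_form B y x"
  "corr_form B (y - z) x = corr_form B y x - corr_form B z x"
  "corr_form B y (x - z) = corr_form B y x - corr_form B y z"
  by (simp_all add: corr_form_def sum.distrib sum_distrib_left sum_negf sum_subtractf
      algebra_simps vec.add vec.scale vec.neg vec.diff)

lemma corr_form_transpose: "corr_form (transpose B) y x = corr_form B x y"
  apply (simp add: corr_form_def matrix_vector_mult_def transpose_def sum_distrib_left)
  apply (subst sum.swap)
  by (simp add: mult_ac)

lemma corr_form_axis: "corr_form B (axis i 1) (axis j 1) = B $ i $ j"
  by (simp add: corr_form_def matrix_vector_mult_def axis_def if_distrib[of "\<lambda>c. c * _"]
      if_distrib[of "\<lambda>c. _ * c"] cong: if_cong)

lemma correlation_image_eq: "correlation_image B L = {y. \<forall>x\<in>L. corr_form B y x = 0}"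
  by (auto simp: correlation_image_def correlation_plane_def corr_form_def)

lemma correlation_image_antimono: "L \<subseteq> M \<Longrightarrow> correlation_image B M \<subseteq> correlation_image B L"
  by (auto simp: correlation_image_eq)

lemma subspace_correlation_image: "vec.subspace (correlation_image B L)"
  by (auto simp: correlation_image_eq vec.subspace_def)

text \<open>
  Adapt a basis of the whole space to \<open>L\<close>. The values of the form on these basis vectors are
  coordinates on the space, and the image of \<open>L\<close> is cut out by the vanishing of those that belong
  to \<open>L\<close>.
\<close>

lemma dim_correlation_image:
  assumes "invertible B" "vec.subspace L"
  shows "vec.dim (correlation_image B L) + vec.dim L = 4"
proof -
  obtain D where D: "D \<subseteq> L" "vec.independent D" "L \<subseteq> vec.span D" "card D = vec.dim L"
    using vec.basis_exists by blast
  define E where "E = vec.extend_basis D"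
  have E: "D \<subseteq> E" "vec.independent E" "vec.span E = UNIV"
    unfolding E_def using D(2)
    by (auto simp: vec.extend_basis_superset vec.independent_extend_basis)
  have "finite E" "card E = 4"
    using E(2,3) by (auto simp: vec.finiteI_independent vec.dim_span_eq_card_independent[symmetric] card_cart_basis)
  then obtain h where h: "bij_betw h (UNIV::4 set) E"
    using finite_same_card_bij[of "UNIV::4 set" E] by auto
  define W where "W = (\<chi> i. h i)"
  have "rows W = E"
    using h by (auto simp: rows_def row_def W_def bij_betw_def)
  then have W: "invertible W"
    using E(3) invertible_left_inverse matrix_left_invertible_span_rows_gen by blast
  define C where "C = W ** transpose B"
  have "invertible C"
    unfolding C_def using W assms(1) by (intro invertible_mult) (simp_all add: invertible_det_nz)
  then have injC: "inj ((*v) C)" and surjC: "surj ((*v) C)"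
    using matrix_left_invertible_injective[of C] matrix_right_invertible_surjective[of C]
    unfolding invertible_def by blast+
  have C: "(C *v y) $ i = corr_form B y (h i)" for y i
  proof -
    have "(C *v y) $ i = (W *v (transpose B *v y)) $ i"
      by (simp only: C_def matrix_vector_mul_assoc)
    also have "\<dots> = corr_form (transpose B) (h i) y"
      unfolding corr_form_def matrix_vector_mult_def[of W] by (simp add: W_def)
    finally show ?thesis by (simp only: corr_form_transpose)
  qed
  define I where "I = h -` D"
  have cardI: "card I = vec.dim L"
  proof -
    have "h ` I = D" using h E(1) by (auto simp: I_def bij_betw_def)
    moreover have "inj_on h I" using h by (auto simp: bij_betw_def inj_on_def)
    ultimately show ?thesis using D(4) card_image by metis
  qed
  have "correlation_image B L = {y. \<forall>x\<in>D. corr_form B y x = 0}"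
  proof -
    have "corr_form B y x = 0" if "\<forall>x\<in>D. corr_form B y x = 0" "x \<in> vec.span D" for x y
      using that(2,1) by (induction rule: vec.span_induct_alt) auto
    then show ?thesis using D(1,3) by (auto simp: correlation_image_eq)
  qed
  also have "\<dots> = {y. \<forall>i. i \<notin> - I \<longrightarrow> (C *v y) $ i = 0}"
    using h E(1) by (auto simp: C I_def bij_betw_def)
  finally have "(*v) C ` correlation_image B L = {z. \<forall>i. i \<notin> - I \<longrightarrow> z $ i = 0}"
    using surjC by (auto simp: surj_def)
  then have "vec.dim ((*v) C ` correlation_image B L) = card (- I)"
    by (simp only: dim_substandard_cart)
  moreover have "vec.dim ((*v) C ` correlation_image B L) = vec.dim (correlation_image B L)"
    by (rule vec.dim_image_eq) (auto intro: inj_on_subset[OF injC])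
  moreover have "card (- I) + card I = 4"
    using card_Un_disjoint[of "- I" I] by (simp add: Compl_partition2)
  ultimately show ?thesis using cardI by simp
qed

text \<open>
  Both sides of the equation have dimension 2, so one inclusion suffices. This reduces every
  statement about images of lines to bilinear identities between spanning vectors.
\<close>

lemma correlation_image_eq_iff:
  assumes "invertible B" "proj_line L" "proj_line M"
  shows "correlation_image B L = M \<longleftrightarrow> (\<forall>x\<in>L. \<forall>y\<in>M. corr_form B y x = 0)"
proof -
  have "vec.dim (correlation_image B L) = vec.dim M"
    using dim_correlation_image[OF assms(1), of L] assms(2,3) by (simp add: proj_subspace_def)
  then have "correlation_image B L = M" if "M \<subseteq> correlation_image B L"
    using that assms(3) vec.subspace_dim_equal[of M "correlation_image B L"] subspace_correlation_image
    by (auto simp: proj_subspace_def)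
  then show ?thesis by (auto simp: correlation_image_eq)
qed

lemma symmetric_iff_corr_form: "transpose B = B \<longleftrightarrow> (\<forall>x y. corr_form B x y = corr_form B y x)"
  using corr_form_transpose[of B]
  by (metis corr_form_axis vec_eq_iff)

section \<open>Coordinates in four-dimensional space\<close>

lemma span2_iff: "x \<in> vec.span {a, b} \<longleftrightarrow> (\<exists>p q. x = p *s a + q *s b)"
  for x :: "complex^4"
  by (auto simp: vec.span_insert algebra_simps)

lemma span3_iff: "x \<in> vec.span {a, b, c} \<longleftrightarrow> (\<exists>p q r. x = p *s a + q *s b + r *s c)"
  for x :: "complex^4"
  by (auto simp: vec.span_insert algebra_simps)

lemma span4_iff: "x \<in> vec.span {a, b, c, d} \<longleftrightarrow> (\<exists>p q r s. x = p *s a + q *s b + r *s c + s *s d)"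
  for x :: "complex^4"
  by (auto simp: vec.span_insert algebra_simps)

lemma independent4D:
  fixes a b c d :: "complex^4"
  assumes "vec.independent {a, b, c, d}" "distinct [a, b, c, d]"
  and eq: "p *s a + q *s b + r *s c + s *s d = 0"
  shows "p = 0 \<and> q = 0 \<and> r = 0 \<and> s = 0"
proof -
  define u where "u x = (if x = a then p else if x = b then q else if x = c then r else s)" for x
  have "(\<Sum>x\<in>{a, b, c, d}. u x *s x) = 0"
    using assms(2) eq by (auto simp: u_def add.assoc)
  then have "\<forall>x\<in>{a, b, c, d}. u x = 0"
    using assms(1) by (simp only: vec.independent_explicit) blast
  then show ?thesis using assms(2) by (auto simp: u_def split: if_splits)
qed

lemma independent4_spans:
  fixes a b c d :: "complex^4"
  assumes "vec.independent {a, b, c, d}" "distinct [a, b, c, d]"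
  obtains p q r s where "x = p *s a + q *s b + r *s c + s *s d"
proof -
  have "UNIV \<subseteq> vec.span {a, b, c, d}"
    using assms by (intro vec.card_ge_dim_independent) (auto simp: card_cart_basis)
  then show ?thesis using that span4_iff by blast
qed

lemma subspace_in_plane:
  assumes "vec.subspace S" "vec.dim S \<le> 3"
  obtains E where "proj_plane E" "S \<subseteq> E"
proof -
  obtain D where D: "D \<subseteq> S" "vec.independent D" "S \<subseteq> vec.span D" "card D = vec.dim S"
    using vec.basis_exists by blast
  define F where "F = vec.extend_basis D"
  have F: "D \<subseteq> F" "vec.independent F" "vec.span F = UNIV"
    unfolding F_def using D(2)
    by (auto simp: vec.extend_basis_superset vec.independent_extend_basis)
  have "finite F" "card F = 4"
    using F(2,3) by (auto simp: vec.finiteI_independent vec.dim_span_eq_card_independent[symmetric] card_cart_basis)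
  then obtain G where G: "D \<subseteq> G" "G \<subseteq> F" "card G = 3"
    using exists_subset_between[of D 3 F] F(1) D(4) assms(2) by auto
  have "vec.independent G" using F(2) G(2) vec.independent_mono by blast
  then have "proj_plane (vec.span G)"
    using G(3) by (simp add: proj_subspace_def vec.dim_eq_card_independent)
  moreover have "S \<subseteq> vec.span G" using D(3) G(1) vec.span_mono by blast
  ultimately show ?thesis using that by blast
qed

lemma proj_point_generator:
  assumes "proj_point P"
  obtains a where "a \<noteq> 0" "P = vec.span {a}"
proof -
  have P: "vec.subspace P" "vec.dim P = 1" using assms by (auto simp: proj_subspace_def)
  then obtain a where a: "a \<in> P" "a \<noteq> 0"
    by (metis vec.dim_eq_0 subsetI singletonI insertCI zero_neq_one)
  have "vec.span {a} = P"
    using P a by (intro vec.subspace_dim_equal) (auto simp: vec.span_minimal)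
  then show ?thesis using that a by blast
qed

section \<open>The polarity of a spatial hexagon\<close>

text \<open>
  Distinctness makes the four-element subsets correspond to the quadruples of vertices, so that the
  second condition says that no four vertices are coplanar.
\<close>

definition general_hexagon ::
    "complex^4 \<Rightarrow> complex^4 \<Rightarrow> complex^4 \<Rightarrow> complex^4 \<Rightarrow> complex^4 \<Rightarrow> complex^4 \<Rightarrow> bool" where
  "general_hexagon a1 a2 a3 a4 a5 a6 \<longleftrightarrow> distinct [a1, a2, a3, a4, a5, a6] \<and>
     (\<forall>D\<subseteq>{a1, a2, a3, a4, a5, a6}. card D = 4 \<longrightarrow> vec.independent D)"

lemma general_hexagon_zero:
  assumes "general_hexagon a1 a2 a3 a4 a5 a6"
  and "distinct [a, b, c, d]" "{a, b, c, d} \<subseteq> {a1, a2, a3, a4, a5, a6}"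
  and "p *s a + q *s b + r *s c + s *s d = 0"
  shows "p = 0 \<and> q = 0 \<and> r = 0 \<and> s = 0"
proof (rule independent4D)
  show "vec.independent {a, b, c, d}"
    using assms(1-3) by (auto simp: general_hexagon_def)
qed (use assms in auto)

text \<open>
  A vanishing coordinate would make four of the vertices coplanar.
\<close>

lemma fifth_vertex_coordinates:
  assumes hex: "general_hexagon a1 a2 a3 a4 a5 a6" and x: "x \<in> {a5, a6}"
  obtains p q r s where "x = p *s a1 + q *s a2 + r *s a3 + s *s a4"
    "p \<noteq> 0" "q \<noteq> 0" "r \<noteq> 0" "s \<noteq> 0"
proof -
  have d: "distinct [a1, a2, a3, a4, x]" and sub: "{a1, a2, a3, a4, x} \<subseteq> {a1, a2, a3, a4, a5, a6}"
    using hex x by (auto simp: general_hexagon_def)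
  have "vec.independent {a1, a2, a3, a4}" using hex by (auto simp: general_hexagon_def)
  then obtain p q r s where eq: "x = p *s a1 + q *s a2 + r *s a3 + s *s a4"
    using independent4_spans[of a1 a2 a3 a4 x] d by (metis distinct_length_2_or_more distinct_singleton)
  note zero = general_hexagon_zero[OF hex]
  have "p \<noteq> 0" using zero[of a2 a3 a4 x q r s "-1"] d sub eq by auto
  moreover have "q \<noteq> 0" using zero[of a1 a3 a4 x p r s "-1"] d sub eq by auto
  moreover have "r \<noteq> 0" using zero[of a1 a2 a4 x p q s "-1"] d sub eq by auto
  moreover have "s \<noteq> 0" using zero[of a1 a2 a3 x p q r "-1"] d sub eq by auto
  ultimately show ?thesis using that eq by blast
qed

text \<open>
  The sides \<open>a1 a2\<close> and \<open>a4 a5\<close> of a hexagon are opposite, and so on cyclically. A correlation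
  interchanges opposite sides if and only if vertices that are not joined by a side are conjugate,
  since every such pair of vertices lies on a pair of opposite sides.
\<close>

definition conjugate_nonadjacent ::
    "complex^4^4 \<Rightarrow> complex^4 \<Rightarrow> complex^4 \<Rightarrow> complex^4 \<Rightarrow> complex^4 \<Rightarrow> complex^4 \<Rightarrow> complex^4 \<Rightarrow> bool" where
  "conjugate_nonadjacent B a1 a2 a3 a4 a5 a6 \<longleftrightarrow>
     (\<forall>(u, v)\<in>{(a1, a3), (a1, a4), (a1, a5), (a2, a4), (a2, a5), (a2, a6), (a3, a5), (a3, a6), (a4, a6)}.
        corr_form B u v = 0 \<and> corr_form B v u = 0)"

text \<open>
  Let \<open>A\<close> be the form minus its transpose. On the basis \<open>a1, \<dots>, a4\<close> it can only be non-zero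
  at the three pairs of consecutive vectors. Expanding \<open>A a1 a5 = 0\<close>, \<open>A a2 a5 = 0\<close> and
  \<open>A a3 a5 = 0\<close> in this basis annihilates these values one after the other, because the coordinates of
  \<open>a5\<close> do not vanish. Hence a correlation that interchanges opposite sides is a polarity.
\<close>

lemma conjugate_nonadjacent_symmetric:
  assumes hex: "general_hexagon a1 a2 a3 a4 a5 a6"
  and conj: "conjugate_nonadjacent B a1 a2 a3 a4 a5 a6"
  shows "transpose B = B"
proof -
  have ind: "vec.independent {a1, a2, a3, a4}" "distinct [a1, a2, a3, a4]"
    using hex by (auto simp: general_hexagon_def)
  obtain p q r s where a5: "a5 = p *s a1 + q *s a2 + r *s a3 + s *s a4"
    and nz: "p \<noteq> 0" "q \<noteq> 0" "r \<noteq> 0" "s \<noteq> 0"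
    by (rule fifth_vertex_coordinates[OF hex, of a5]) auto
  define A where "A u v = corr_form B u v - corr_form B v u" for u v
  have A: "A u (v + w) = A u v + A u w" "A (v + w) u = A v u + A w u"
    "A u (c *s v) = c * A u v" "A (c *s v) u = c * A v u" "A v v = 0" for u v w c
    by (simp_all add: A_def algebra_simps)
  have anti: "A u v = - A v u" for u v by (simp add: A_def)
  have z: "A a1 a3 = 0" "A a1 a4 = 0" "A a2 a4 = 0" "A a1 a5 = 0" "A a2 a5 = 0" "A a3 a5 = 0"
    using conj by (auto simp: A_def conjugate_nonadjacent_def)
  have 12: "A a1 a2 = 0" using z nz by (simp add: a5 A)
  have 23: "A a2 a3 = 0" using z nz 12 anti[of a2 a1] by (simp add: a5 A)
  have 34: "A a3 a4 = 0" using z nz 23 anti[of a3 a2] anti[of a3 a1] by (simp add: a5 A)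
  have "A x y = 0" for x y
  proof -
    obtain x1 x2 x3 x4 where x: "x = x1 *s a1 + x2 *s a2 + x3 *s a3 + x4 *s a4"
      using independent4_spans[OF ind] .
    obtain y1 y2 y3 y4 where y: "y = y1 *s a1 + y2 *s a2 + y3 *s a3 + y4 *s a4"
      using independent4_spans[OF ind] .
    show ?thesis
      unfolding x y using 12 23 34 z anti[of a2 a1] anti[of a3 a1] anti[of a4 a1] anti[of a3 a2]
        anti[of a4 a2] anti[of a4 a3]
      by (simp add: A)
  qed
  then show ?thesis by (simp add: symmetric_iff_corr_form A_def)
qed

lemma dual_coordinates:
  fixes a1 a2 a3 a4 :: "complex^4"
  assumes "vec.independent {a1, a2, a3, a4}" "distinct [a1, a2, a3, a4]"
  obtains M :: "complex^4^4" where "M *v a1 = axis 1 1" "M *v a2 = axis 2 1"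
    "M *v a3 = axis 3 1" "M *v a4 = axis 4 1"
proof -
  define e :: "complex^4 \<Rightarrow> complex^4" where "e x = axis (if x = a1 then 1 else if x = a2 then 2 else if x = a3 then 3 else 4) 1" for x
  obtain g where g: "Vector_Spaces.linear (*s) (*s) g" "\<forall>x\<in>{a1, a2, a3, a4}. g x = e x"
    using vec.linear_independent_extend[OF assms(1), of e] by auto
  show ?thesis
    using assms(2) g by (intro that[of "matrix g"]) (auto simp: matrix_works e_def)
qed

lemma tridiagonal_form:
  fixes a1 a2 a3 a4 :: "complex^4"
  assumes "vec.independent {a1, a2, a3, a4}" "distinct [a1, a2, a3, a4]"
  obtains B where "transpose B = B"
    "corr_form B a1 a1 = b11" "corr_form B a2 a2 = b22" "corr_form B a3 a3 = b33" "corr_form B a4 a4 = b44"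
    "corr_form B a1 a2 = b12" "corr_form B a2 a3 = b23" "corr_form B a3 a4 = b34"
    "corr_form B a1 a3 = 0" "corr_form B a1 a4 = 0" "corr_form B a2 a4 = 0"
proof -
  obtain M :: "complex^4^4" where M: "M *v a1 = axis 1 1" "M *v a2 = axis 2 1"
    "M *v a3 = axis 3 1" "M *v a4 = axis 4 1"
    using dual_coordinates[OF assms] .
  define G :: "complex^4^4" where "G = (\<chi> i j.
     if i = j then if i = 1 then b11 else if i = 2 then b22 else if i = 3 then b33 else b44
     else if {i, j} = {1, 2} then b12 else if {i, j} = {2, 3} then b23
     else if {i, j} = {3, 4} then b34 else 0)"
  have "transpose G = G"
    by (simp add: G_def transpose_def vec_eq_iff insert_commute)
  define B where "B = transpose M ** G ** M"
  have B: "corr_form B y x = corr_form G (M *v y) (M *v x)" for y x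
    using corr_form_transpose[of M y "G *v (M *v x)"]
    by (simp add: B_def corr_form_def matrix_vector_mul_assoc[symmetric] mult.commute)
  have "transpose B = B"
    using \<open>transpose G = G\<close> by (simp add: symmetric_iff_corr_form B)
  then show ?thesis
    by (rule that) (simp_all add: B M corr_form_axis G_def doubleton_eq_iff)
qed

text \<open>
  In the basis \<open>a1, \<dots>, a4\<close> the required form is tridiagonal. Conjugacy of \<open>a5\<close> with \<open>a1, a2, a3\<close> and
  of \<open>a6\<close> with \<open>a2, a3, a4\<close> are six linear equations for its seven entries. Eliminating the diagonal,
  they say that the off-diagonal entries are inversely proportional to the minors \<open>m12\<close>, \<open>m23\<close>, \<open>m34\<close>
  of the coordinates of \<open>a5\<close> and \<open>a6\<close>. The form is non-degenerate: its off-diagonal entries do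
  not vanish, so the vectors orthogonal to \<open>a1, a2, a3\<close> are the multiples of \<open>a5\<close>, and \<open>a5\<close> is not
  orthogonal to \<open>a4\<close>.
\<close>

lemma polarity_of_hexagon:
  assumes hex: "general_hexagon a1 a2 a3 a4 a5 a6"
  obtains B where "invertible B" "transpose B = B" "conjugate_nonadjacent B a1 a2 a3 a4 a5 a6"
proof -
  have ind: "vec.independent {a1, a2, a3, a4}" "distinct [a1, a2, a3, a4]"
    and dist: "distinct [a1, a2, a3, a4, a5, a6]"
    using hex by (auto simp: general_hexagon_def)
  obtain c1 c2 c3 c4 where a5: "a5 = c1 *s a1 + c2 *s a2 + c3 *s a3 + c4 *s a4"
    and c: "c1 \<noteq> 0" "c2 \<noteq> 0" "c3 \<noteq> 0" "c4 \<noteq> 0"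
    by (rule fifth_vertex_coordinates[OF hex, of a5]) auto
  obtain d1 d2 d3 d4 where a6: "a6 = d1 *s a1 + d2 *s a2 + d3 *s a3 + d4 *s a4"
    and d: "d1 \<noteq> 0" "d2 \<noteq> 0" "d3 \<noteq> 0" "d4 \<noteq> 0"
    by (rule fifth_vertex_coordinates[OF hex, of a6]) auto
  \<comment> \<open>A vanishing minor would allow two coordinates to be eliminated from \<open>a5\<close> and \<open>a6\<close> at once,
     which leaves a linear relation between four vertices.\<close>
  define m12 m23 m34 where m: "m12 = c1 * d2 - c2 * d1" "m23 = c2 * d3 - c3 * d2" "m34 = c3 * d4 - c4 * d3"
  note zero = general_hexagon_zero[OF hex]
  have "m12 \<noteq> 0"
  proof
    assume "m12 = 0"
    then have "d1 *s a5 + (- c1) *s a6 + (c1 * d3 - c3 * d1) *s a3 + (c1 * d4 - c4 * d1) *s a4 = 0"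
      unfolding m by (simp add: a5 a6 vec_eq_iff algebra_simps)
    from zero[OF _ _ this] show False using dist d by auto
  qed
  have "m23 \<noteq> 0"
  proof
    assume "m23 = 0"
    then have "d2 *s a5 + (- c2) *s a6 + (c2 * d1 - c1 * d2) *s a1 + (c2 * d4 - c4 * d2) *s a4 = 0"
      unfolding m by (simp add: a5 a6 vec_eq_iff algebra_simps)
    from zero[OF _ _ this] show False using dist d by auto
  qed
  have "m34 \<noteq> 0"
  proof
    assume "m34 = 0"
    then have "d3 *s a5 + (- c3) *s a6 + (c3 * d1 - c1 * d3) *s a1 + (c3 * d2 - c2 * d3) *s a2 = 0"
      unfolding m by (simp add: a5 a6 vec_eq_iff algebra_simps)
    from zero[OF _ _ this] show False using dist d by auto
  qed
  \<comment> \<open>The reciprocals of the minors, multiplied by the product of all three.\<close>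
  define b12 b23 b34 where b: "b12 = m23 * m34" "b23 = m12 * m34" "b34 = m12 * m23"
  have b_nz: "b12 \<noteq> 0" "b23 \<noteq> 0" "b34 \<noteq> 0"
    using \<open>m12 \<noteq> 0\<close> \<open>m23 \<noteq> 0\<close> \<open>m34 \<noteq> 0\<close> by (auto simp: b)
  \<comment> \<open>Three diagonal entries are read off from the equations of \<open>a5\<close>, the last from those of \<open>a6\<close>.\<close>
  define b11 b22 b33 b44 where bd: "b11 = - c2 * b12 / c1" "b22 = - (c1 * b12 + c3 * b23) / c2"
    "b33 = - (c2 * b23 + c4 * b34) / c3" "b44 = - d3 * b34 / d4"
  have c_eq: "c1 * b11 + c2 * b12 = 0" "c1 * b12 + c2 * b22 + c3 * b23 = 0" "c2 * b23 + c3 * b33 + c4 * b34 = 0"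
    using c by (simp_all add: bd)
  have "c2 * (d1 * b12 + d2 * b22 + d3 * b23) = 0" "c3 * (d2 * b23 + d3 * b33 + d4 * b34) = 0"
    using c by (simp_all add: bd b m field_simps)
  then have d_eq: "d1 * b12 + d2 * b22 + d3 * b23 = 0" "d2 * b23 + d3 * b33 + d4 * b34 = 0" "d3 * b34 + d4 * b44 = 0"
    using c d by (simp_all add: bd)
  obtain B where sym: "transpose B = B" and B:
    "corr_form B a1 a1 = b11" "corr_form B a2 a2 = b22" "corr_form B a3 a3 = b33" "corr_form B a4 a4 = b44"
    "corr_form B a1 a2 = b12" "corr_form B a2 a3 = b23" "corr_form B a3 a4 = b34"
    "corr_form B a1 a3 = 0" "corr_form B a1 a4 = 0" "corr_form B a2 a4 = 0"
    using tridiagonal_form[OF ind] .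
  have comm: "corr_form B x y = corr_form B y x" for x y
    using sym by (simp add: symmetric_iff_corr_form)
  have B': "corr_form B a2 a1 = b12" "corr_form B a3 a2 = b23" "corr_form B a4 a3 = b34"
    "corr_form B a3 a1 = 0" "corr_form B a4 a1 = 0" "corr_form B a4 a2 = 0"
    using B by (simp_all add: comm[of a2 a1] comm[of a3 a2] comm[of a4 a3] comm[of a3 a1] comm[of a4 a1] comm[of a4 a2])
  have conj: "conjugate_nonadjacent B a1 a2 a3 a4 a5 a6"
    unfolding conjugate_nonadjacent_def using c_eq d_eq
    by (simp add: comm[of a5 a1] comm[of a5 a2] comm[of a5 a3] comm[of a6 a2] comm[of a6 a3] comm[of a6 a4]) (simp add: a5 a6 B B')
  have "x = 0" if "B *v x = 0" for x
  proof -
    obtain x1 x2 x3 x4 where x: "x = x1 *s a1 + x2 *s a2 + x3 *s a3 + x4 *s a4"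
      using independent4_spans[OF ind] .
    have ker: "corr_form B y x = 0" for y using that by (simp add: corr_form_def)
    have e: "x1 * b11 + x2 * b12 = 0" "x1 * b12 + x2 * b22 + x3 * b23 = 0"
      "x2 * b23 + x3 * b33 + x4 * b34 = 0" "x3 * b34 + x4 * b44 = 0"
      using ker[of a1] ker[of a2] ker[of a3] ker[of a4] by (simp_all add: x B B')
    \<comment> \<open>The first three equations force \<open>x = t *s a5\<close>, the fourth then gives \<open>t = 0\<close>.\<close>
    define t where "t = x1 / c1"
    have x1: "x1 = t * c1" using c by (simp add: t_def)
    have "b12 * x2 = b12 * (t * c2)" using e(1) c_eq(1) x1 by algebra
    then have x2: "x2 = t * c2" using b_nz by simp
    have "b23 * x3 = b23 * (t * c3)" using e(2) c_eq(2) x1 x2 by algebra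
    then have x3: "x3 = t * c3" using b_nz by simp
    have "b34 * x4 = b34 * (t * c4)" using e(3) c_eq(3) x3 x2 by algebra
    then have x4: "x4 = t * c4" using b_nz by simp
    have "t * (m34 * b34) = 0"
      using e(4) d_eq(3) unfolding x3 x4 m by algebra
    then have "t = 0" using \<open>m34 \<noteq> 0\<close> b_nz by simp
    then show "x = 0" by (simp add: x x1 x2 x3 x4)
  qed
  then have "invertible B"
    by (simp add: invertible_left_inverse matrix_left_invertible_ker)
  then show ?thesis using that sym conj by blast
qed

section \<open>Transversals of alternate sides of a hexagon\<close>

lemma proj_line_span:
  fixes u v :: "complex^4"
  assumes "u \<noteq> 0" "v \<notin> vec.span {u}"
  shows "proj_line (vec.span {u, v})"
proof -
  have "vec.independent {v, u}" "v \<noteq> u"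
    using assms by (auto simp: vec.independent_insert vec.span_base)
  then show ?thesis
    by (simp add: proj_subspace_def vec.dim_eq_card_independent insert_commute)
qed

lemma line_through:
  assumes "proj_line L" "u \<in> L" "v \<in> L" "u \<noteq> 0" "v \<notin> vec.span {u}"
  shows "vec.span {u, v} = L"
proof (rule vec.subspace_dim_equal)
  show "vec.span {u, v} \<subseteq> L"
    using assms by (simp add: proj_subspace_def vec.span_minimal)
qed (use assms proj_line_span[of u v] in \<open>auto simp: proj_subspace_def\<close>)

lemma general_hexagon_skew:
  assumes "general_hexagon a1 a2 a3 a4 a5 a6"
  and "distinct [a, b, c, d]" "{a, b, c, d} \<subseteq> {a1, a2, a3, a4, a5, a6}"
  and "x \<in> vec.span {a, b}" "x \<in> vec.span {c, d}"
  shows "x = 0"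
proof -
  obtain p q r s where x: "x = p *s a + q *s b" "x = r *s c + s *s d"
    using assms(4,5) unfolding span2_iff by blast
  then have "p *s a + q *s b = r *s c + s *s d" by simp
  then have "p *s a + q *s b + (- r) *s c + (- s) *s d = 0"
    by (simp add: algebra_simps)
  from general_hexagon_zero[OF assms(1-3) this] show ?thesis using x by simp
qed

lemma general_hexagon_side:
  assumes "general_hexagon a1 a2 a3 a4 a5 a6" "a \<noteq> b" "{a, b} \<subseteq> {a1, a2, a3, a4, a5, a6}"
  shows "proj_line (vec.span {a, b})"
proof -
  obtain D where D: "{a, b} \<subseteq> D" "D \<subseteq> {a1, a2, a3, a4, a5, a6}" "card D = 4"
    using exists_subset_between[of "{a, b}" 4 "{a1, a2, a3, a4, a5, a6}"] assms
    by (auto simp: general_hexagon_def)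
  then have "vec.independent {a, b}"
    using assms(1) vec.independent_mono unfolding general_hexagon_def by metis
  then show ?thesis
    using assms(2) by (simp add: proj_subspace_def vec.dim_eq_card_independent)
qed

text \<open>
  The heart of the proof. The line \<open>L\<close> meets three alternate sides in \<open>x1\<close>, \<open>x2\<close>, \<open>x3\<close>; the point \<open>y\<close> lies
  on the side opposite to \<open>a6 a1\<close>, so it is conjugate to \<open>x1\<close>, and it is conjugate to the whole of \<open>L\<close>
  if and only if it is conjugate to \<open>x2\<close>.

  Let \<open>z\<close> be the point in which the plane through \<open>x1, a2, a5\<close> meets the side \<open>a3 a4\<close>, and write \<open>x1\<close> as
  a combination of \<open>x2\<close> and \<open>x3\<close>. As \<open>a2 a3\<close> and \<open>a4 a5\<close> are skew, the resulting relation splits into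
  two, and the first expresses \<open>x2\<close> through \<open>a3\<close> and \<open>a2\<close>. Evaluating the form at \<open>z\<close>, once on
  the combination of \<open>x1, a2, a5\<close> and once on that of \<open>a3, a4\<close>, yields two terms that cancel by symmetry.
  Hence \<open>z\<close> is conjugate to \<open>L\<close>. It is the only such point on \<open>a3 a4\<close>, since otherwise \<open>x2\<close> would lie on
  the image \<open>a6 a1\<close> of that side.
\<close>

lemma transversal_conjugate_iff:
  assumes hex: "general_hexagon a1 a2 a3 a4 a5 a6"
  and inv: "invertible B" and conj: "conjugate_nonadjacent B a1 a2 a3 a4 a5 a6"
  and L: "proj_line L" "x1 \<in> L" "x2 \<in> L" "x3 \<in> L"
  and nz: "x1 \<noteq> 0" "x2 \<noteq> 0" "x3 \<noteq> 0"
  and x1: "x1 \<in> vec.span {a6, a1}" and x2: "x2 \<in> vec.span {a2, a3}" and x3: "x3 \<in> vec.span {a4, a5}"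
  and y: "y \<in> vec.span {a3, a4}"
  shows "y \<in> vec.span {x1, a2, a5} \<longleftrightarrow> (\<forall>x\<in>L. corr_form B y x = 0)"
proof -
  have dist: "distinct [a1, a2, a3, a4, a5, a6]" using hex by (simp add: general_hexagon_def)
  have sym: "corr_form B x z = corr_form B z x" for x z
    using conjugate_nonadjacent_symmetric[OF hex conj] symmetric_iff_corr_form by blast
  have orth: "corr_form B a1 a3 = 0" "corr_form B a1 a4 = 0" "corr_form B a3 a5 = 0"
    "corr_form B a2 a4 = 0" "corr_form B a3 a6 = 0" "corr_form B a4 a6 = 0"
    using conj by (auto simp: conjugate_nonadjacent_def)
  have orth': "corr_form B a3 a1 = 0" "corr_form B a4 a1 = 0" "corr_form B a5 a3 = 0"
    "corr_form B a4 a2 = 0" "corr_form B a6 a3 = 0" "corr_form B a6 a4 = 0"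
    using orth sym by metis+
  note skew = general_hexagon_skew[OF hex]
  have skew12: "x1 \<notin> vec.span {a2, a3}" using skew[OF _ _ x1, of a2 a3] dist nz by auto
  have skew13: "x1 \<notin> vec.span {a4, a5}" using skew[OF _ _ x1, of a4 a5] dist nz by auto
  have skew23: "x2 \<notin> vec.span {a4, a5}" using skew[OF _ _ x2, of a4 a5] dist nz by auto
  have "vec.span {x2} \<subseteq> vec.span {a2, a3}" "vec.span {x3} \<subseteq> vec.span {a4, a5}"
    using x2 x3 by (simp_all add: vec.span_minimal)
  then have "x1 \<notin> vec.span {x2}" "x2 \<notin> vec.span {x3}" using skew12 skew23 by auto
  then have L12: "vec.span {x2, x1} = L" and L23: "vec.span {x3, x2} = L"
    using L nz line_through by metis+
  obtain m n where mn: "x1 = m *s x2 + n *s x3"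
    using L(2) unfolding L23[symmetric] span2_iff by (metis add.commute)
  obtain u v where uv: "x2 = u *s a2 + v *s a3" using x2 by (auto simp: span2_iff)
  obtain p q where pq: "x3 = p *s a4 + q *s a5" using x3 by (auto simp: span2_iff)
  obtain c d where cd: "x1 = c *s a6 + d *s a1" using x1 by (auto simp: span2_iff)
  have conj_L: "corr_form B z x = 0"
    if z: "z \<in> vec.span {a3, a4}" "z \<in> vec.span {x1, a2, a5}" and x: "x \<in> L" for z x
  proof (cases "z = 0")
    case False
    obtain s t where st: "z = s *s a3 + t *s a4" using z(1) by (auto simp: span2_iff)
    obtain \<alpha> \<beta> \<gamma> where z_plane: "z = \<alpha> *s x1 + \<beta> *s a2 + \<gamma> *s a5"
      using z(2) by (auto simp: span3_iff)
    have "(\<alpha> * m * u + \<beta>) *s a2 + (\<alpha> * m * v - s) *s a3 + (\<alpha> * n * p - t) *s a4 + (\<alpha> * n * q + \<gamma>) *s a5 = 0"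
      using st z_plane unfolding mn uv pq by (simp add: vec_eq_iff algebra_simps)
    from general_hexagon_zero[OF hex _ _ this]
    have coeff: "\<beta> = - (\<alpha> * m * u)" "s = \<alpha> * m * v" "t = \<alpha> * n * p"
      using dist by (auto simp: eq_neg_iff_add_eq_0 add.commute)
    have zx1: "corr_form B z x1 = 0" by (simp add: st cd orth orth')
    have "\<alpha> \<noteq> 0" using False st coeff by auto
    moreover have "m \<noteq> 0"
      using skew13 mn x3 by (auto simp: vec.span_scale)
    moreover have "\<alpha> * m * corr_form B z x2 = 0"
    proof -
      have "corr_form B z a3 = \<beta> * corr_form B a2 a3"
        by (simp add: z_plane cd orth orth')
      moreover have "corr_form B z a2 = s * corr_form B a3 a2"
        by (simp add: st orth orth')
      ultimately show ?thesis
        using sym[of a3 a2] by (simp add: uv coeff algebra_simps)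
    qed
    ultimately have "corr_form B z x2 = 0" by simp
    then show ?thesis
      using x zx1 unfolding L12[symmetric] by (auto simp: span2_iff)
  qed simp
  show ?thesis
  proof
    assume y_conj: "\<forall>x\<in>L. corr_form B y x = 0"
    \<comment> \<open>The intersection point \<open>z\<close>: the two expressions exhibit it in the plane and on the side.\<close>
    define z where "z = x1 - (m * u) *s a2 - (n * q) *s a5"
    have z_eq: "z = (m * v) *s a3 + (n * p) *s a4"
      by (simp add: z_def mn uv pq vec_eq_iff algebra_simps)
    have z_line: "z \<in> vec.span {a3, a4}" unfolding span2_iff using z_eq by blast
    have z_plane: "z \<in> vec.span {x1, a2, a5}"
      unfolding z_def by (intro vec.span_diff vec.span_scale vec.span_base) auto
    have "z \<noteq> 0"
    proof
      assume "z = 0"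
      then have "x1 = (m * u) *s a2 + (n * q) *s a5" by (simp add: z_def algebra_simps)
      then have "x1 \<in> vec.span {a2, a5}" unfolding span2_iff by blast
      then show False using skew[OF _ _ x1, of a2 a5] dist nz by auto
    qed
    have "y \<in> vec.span {z}"
    proof (rule ccontr)
      assume "y \<notin> vec.span {z}"
      then have yz: "vec.span {z, y} = vec.span {a3, a4}"
        using z_line y \<open>z \<noteq> 0\<close> dist by (intro line_through general_hexagon_side[OF hex]) auto
      have "corr_form B x2 w = 0" if "w \<in> vec.span {a3, a4}" for w
        using that y_conj conj_L[OF z_line z_plane] L(3) unfolding yz[symmetric]
        by (auto simp: span2_iff sym[of x2])
      then have "x2 \<in> correlation_image B (vec.span {a3, a4})"
        by (simp add: correlation_image_eq)
      also have "correlation_image B (vec.span {a3, a4}) = vec.span {a6, a1}"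
      proof (subst correlation_image_eq_iff[OF inv])
        show "proj_line (vec.span {a3, a4})" "proj_line (vec.span {a6, a1})"
          using dist by (intro general_hexagon_side[OF hex]; force)+
      qed (auto simp: span2_iff orth orth')
      finally show False using skew[OF _ _ x2, of a6 a1] dist nz by auto
    qed
    then obtain k where "y = k *s z" by (auto simp: vec.span_insert)
    then show "y \<in> vec.span {x1, a2, a5}" using z_plane by (simp add: vec.span_scale)
  qed (use conj_L y in blast)
qed

section \<open>Edge points of an elementary cube\<close>

lemma span_singleton_swap:
  fixes u v :: "complex^4"
  assumes "v \<noteq> 0" "v \<in> vec.span {u}"
  shows "vec.span {u} = vec.span {v}"
proof -
  obtain c where c: "v = c *s u" using assms(2) by (auto simp: vec.span_insert)
  then have "u = inverse c *s v" using assms(1) by auto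
  then have "u \<in> vec.span {v}" by (metis vec.span_base vec.span_scale singletonI)
  then show ?thesis
    using assms(2) by (intro equalityI vec.span_minimal) auto
qed

lemma proj_join_span: "proj_join (vec.span {u}) (vec.span {v}) = vec.span {u, v}"
proof
  show "proj_join (vec.span {u}) (vec.span {v}) \<subseteq> vec.span {u, v}"
    unfolding proj_join_def
    by (intro vec.span_minimal Un_least vec.span_mono) auto
  show "vec.span {u, v} \<subseteq> proj_join (vec.span {u}) (vec.span {v})"
    unfolding proj_join_def by (intro vec.span_mono) (auto intro: vec.span_base)
qed

lemma UNIV_3_eq: "distinct [i, j, k] \<Longrightarrow> UNIV = {i, j, k :: 3}"
  by (rule card_subset_eq[symmetric]) auto

lemma cube_vertex_empty [simp]: "cube_vertex n {} = n"
  by (simp add: cube_vertex_def)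

lemma cube_vertex_insert:
  "i \<notin> S \<Longrightarrow> cube_vertex n (insert i S) = cube_vertex n S + dir i"
  by (simp add: cube_vertex_def add.commute add.left_commute)

lemma edge_point_eq:
  "i \<notin> S \<Longrightarrow> edge_point l n (S, i) = l (cube_vertex n S) \<inter> l (cube_vertex n (insert i S))"
  by (simp add: edge_point_def meet_point_def cube_vertex_insert)

locale intersecting_complex =
  fixes l :: "int^3 \<Rightarrow> (complex^4) set"
  assumes line_complex: "line_complex l"
  and general_position: "general_position l"
  and neighbours_intersect: "neighbours_intersect l"
begin

lemma proj_line_complex: "proj_line (l n)"
  using line_complex by (simp add: line_complex_def)

lemma proj_point_meet: "proj_point (meet_point l i n)"
proof -
  let ?L = "l n" and ?M = "l (n + dir i)"
  have L: "vec.subspace ?L" "vec.dim ?L = 2" and M: "vec.subspace ?M" "vec.dim ?M = 2"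
    using proj_line_complex by (auto simp: proj_subspace_def)
  have "vec.dim (?L \<inter> ?M) \<noteq> 2"
  proof
    assume "vec.dim (?L \<inter> ?M) = 2"
    then have "?L \<inter> ?M = ?L" "?L \<inter> ?M = ?M"
      using L M by (intro vec.subspace_dim_equal; simp add: vec.subspace_inter)+
    then have "l n = l (n + dir i)" by simp
    then show False using general_position unfolding general_position_def by blast
  qed
  moreover have "vec.dim (?L \<inter> ?M) \<le> 2"
    using vec.dim_subset[of "?L \<inter> ?M" ?L] L by simp
  moreover have "1 \<le> vec.dim (?L \<inter> ?M)"
  proof -
    obtain P where "proj_point P" "P \<subseteq> ?L \<inter> ?M"
      using neighbours_intersect unfolding neighbours_intersect_def proj_intersect_def by blast
    then show ?thesis using vec.dim_subset[of P "?L \<inter> ?M"] by (simp add: proj_subspace_def)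
  qed
  ultimately show ?thesis
    using L M by (simp add: proj_subspace_def meet_point_def vec.subspace_inter)
qed

lemma edge_generators:
  obtains a where "\<And>S i. i \<notin> S \<Longrightarrow> a (S, i) \<noteq> 0"
    "\<And>S i. i \<notin> S \<Longrightarrow> edge_point l n (S, i) = vec.span {a (S, i)}"
proof -
  have "\<exists>x. x \<noteq> 0 \<and> edge_point l n d = vec.span {x}" for d
  proof (cases d)
    case (Pair S i)
    obtain x where "x \<noteq> 0" "meet_point l i (cube_vertex n S) = vec.span {x}"
      using proj_point_generator[OF proj_point_meet] .
    then show ?thesis using Pair by (auto simp: edge_point_def)
  qed
  then obtain a where "\<And>d. a d \<noteq> 0 \<and> edge_point l n d = vec.span {a d}" by metis
  then show ?thesis using that by blast
qed

lemma edge_points_distinct: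
  assumes "S \<in> edge_ends (T, i)" "S \<in> edge_ends (T', i')" "i \<notin> T" "i' \<notin> T'" "(T, i) \<noteq> (T', i')"
  shows "edge_point l n (T, i) \<noteq> edge_point l n (T', i')"
  using general_position neighbours_intersect assms unfolding general_position_def cube_edges_def
  by blast

text \<open>
  If the vectors of four points did not span the whole space, these points would lie on a common plane.
  Injectivity follows as well, since any two of the edges are among four.
\<close>

lemma hexagon_points_independent:
  assumes F: "F \<subseteq> hexagon_edges {}" "4 \<le> card F"
  and a: "\<And>d. d \<in> F \<Longrightarrow> edge_point l n d = vec.span {a d}"
  shows "inj_on a F" "\<And>D. D \<subseteq> a ` F \<Longrightarrow> card D = 4 \<Longrightarrow> vec.independent D"
proof -
  have *: "inj_on a D \<and> vec.independent (a ` D)" if D: "D \<subseteq> F" "card D = 4" for D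
  proof -
    have fin: "finite D" using D(2) by (metis card.infinite zero_neq_numeral)
    have "\<not> vec.dim (a ` D) \<le> 3"
    proof
      assume "vec.dim (a ` D) \<le> 3"
      then obtain E where "proj_plane E" "vec.span (a ` D) \<subseteq> E"
        using subspace_in_plane[of "vec.span (a ` D)"] by auto
      moreover have "edge_point l n d \<subseteq> vec.span (a ` D)" if "d \<in> D" for d
        proof -
        have "edge_point l n d = vec.span {a d}" using that D(1) a by blast
        then show ?thesis using that vec.span_mono[of "{a d}" "a ` D"] by simp
      qed
      ultimately have "proj_coplanar (edge_point l n ` D)"
        unfolding proj_coplanar_def by blast
      moreover have "D \<subseteq> hexagon_edges {}" using D F by blast
      ultimately show False
        using D(2) general_position neighbours_intersect unfolding general_position_def by blast
    qed
    moreover have "card (a ` D) \<le> 4" "vec.dim (a ` D) \<le> card (a ` D)"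
      using D(2) fin card_image_le[of D a] vec.dim_le_card[OF vec.span_superset, of "a ` D"] by auto
    ultimately have "card (a ` D) = 4" "vec.dim (a ` D) = 4" by auto
    then show ?thesis
      using D(2) fin vec.card_eq_dim[of "a ` D" "a ` D"] by (auto intro: eq_card_imp_inj_on vec.span_base)
  qed
  have finF: "finite F" using F(2) by (metis card.infinite not_numeral_le_zero)
  show inj: "inj_on a F"
  proof (rule inj_onI)
    fix d d' assume d: "d \<in> F" "d' \<in> F" "a d = a d'"
    have "card {d, d'} \<le> 4" by (cases "d = d'") auto
    then obtain D where "{d, d'} \<subseteq> D" "D \<subseteq> F" "card D = 4"
      using exists_subset_between[of "{d, d'}" 4 F] d F(2) finF by auto
    then show "d = d'" using * d(3) by (auto dest: inj_onD)
  qed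
  show "vec.independent D" if D: "D \<subseteq> a ` F" "card D = 4" for D
  proof -
    obtain D' where "D' \<subseteq> F" "D = a ` D'" using D(1) by (meson subset_imageE)
    then show ?thesis using * D(2) card_image inj inj_on_subset by metis
  qed
qed

lemma general_hexagon_cube:
  assumes "distinct [i, j, k]"
  and a: "\<And>S i. i \<notin> S \<Longrightarrow> edge_point l n (S, i) = vec.span {a (S, i)}"
  shows "general_hexagon (a ({i}, j)) (a ({j}, i)) (a ({j}, k)) (a ({k}, j)) (a ({k}, i)) (a ({i}, k))"
proof -
  define F where "F = {({i}, j), ({j}, i), ({j}, k), ({k}, j), ({k}, i), ({i}, k)}"
  have "F \<subseteq> hexagon_edges {}"
    using assms(1) by (auto simp: F_def hexagon_edges_def cube_edges_def edge_ends_def UNIV_3_eq[OF assms(1)])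
  moreover have "4 \<le> card F" using assms(1) by (auto simp: F_def card_insert_if)
  moreover have "edge_point l n d = vec.span {a d}" if "d \<in> F" for d
    using that assms(1) a by (auto simp: F_def)
  ultimately have *: "inj_on a F" "\<And>D. D \<subseteq> a ` F \<Longrightarrow> card D = 4 \<Longrightarrow> vec.independent D"
    using hexagon_points_independent by blast+
  have "distinct [a ({i}, j), a ({j}, i), a ({j}, k), a ({k}, j), a ({k}, i), a ({i}, k)]"
  proof -
    have "distinct (map a [({i}, j), ({j}, i), ({j}, k), ({k}, j), ({k}, i), ({i}, k)])"
      unfolding distinct_map using *(1) assms(1) by (auto simp: F_def)
    then show ?thesis by (simp only: list.map)
  qed
  then show ?thesis
    using *(2) unfolding general_hexagon_def F_def by (simp only: image_insert image_empty) blast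
qed

end

section \<open>The hexagon of a labelled cube\<close>

text \<open>
  Generators of the twelve edge points of a cube, and a labelling of the directions. The labelling is
  left arbitrary so that each of the three planarity conditions is an instance of the one for \<open>i\<close>.
  The six generators \<open>a1, \<dots>, a6\<close> run through the hexagon that omits the lines at \<open>{}\<close> and \<open>UNIV\<close>.
\<close>

locale labelled_cube = intersecting_complex +
  fixes n :: "int^3" and i j k :: 3 and a :: "3 set \<times> 3 \<Rightarrow> complex^4"
  assumes distinct_directions: "distinct [i, j, k]"
  and generator_nonzero: "\<And>S m. m \<notin> S \<Longrightarrow> a (S, m) \<noteq> 0"
  and generator: "\<And>S m. m \<notin> S \<Longrightarrow> edge_point l n (S, m) = vec.span {a (S, m)}"
begin

abbreviation "V S \<equiv> l (cube_vertex n S)"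

abbreviation "a1 \<equiv> a ({i}, j)"
abbreviation "a2 \<equiv> a ({j}, i)"
abbreviation "a3 \<equiv> a ({j}, k)"
abbreviation "a4 \<equiv> a ({k}, j)"
abbreviation "a5 \<equiv> a ({k}, i)"
abbreviation "a6 \<equiv> a ({i}, k)"

lemma directions_neq: "i \<noteq> j" "j \<noteq> i" "i \<noteq> k" "k \<noteq> i" "j \<noteq> k" "k \<noteq> j"
  using distinct_directions by auto

lemmas UNIV_directions = UNIV_3_eq[OF distinct_directions]

lemma complements: "- {i} = {j, k}" "- {j} = {i, k}" "- {k} = {i, j}"
  "- {j, k} = {i}" "- {i, k} = {j}" "- {i, j} = {k}"
  using directions_neq by (auto simp: Compl_eq_Diff_UNIV UNIV_directions)

lemma generator_in_line:
  assumes "m \<notin> S"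
  shows "a (S, m) \<in> V S" "a (S, m) \<in> V (insert m S)"
  using generator[OF assms] edge_point_eq[OF assms, of l n] vec.span_base[of "a (S, m)" "{a (S, m)}"] by auto

lemma hexagon: "general_hexagon a1 a2 a3 a4 a5 a6"
  by (rule general_hexagon_cube[OF distinct_directions generator])

lemma hexagon_distinct: "distinct [a1, a2, a3, a4, a5, a6]"
  using hexagon unfolding general_hexagon_def by blast

lemma hexagon_sides:
  "V {i} = vec.span {a6, a1}" "V {i, j} = vec.span {a1, a2}" "V {j} = vec.span {a2, a3}"
  "V {j, k} = vec.span {a3, a4}" "V {k} = vec.span {a4, a5}" "V {i, k} = vec.span {a5, a6}"
proof -
  have side: "V S = vec.span {u, v}"
    if "u \<in> V S" "v \<in> V S" "u \<noteq> v" "{u, v} \<subseteq> {a1, a2, a3, a4, a5, a6}" for S u v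
  proof (rule vec.subspace_dim_equal[symmetric])
    show "vec.span {u, v} \<subseteq> V S"
      using that proj_line_complex by (intro vec.span_minimal) (auto simp: proj_subspace_def)
  qed (use proj_line_complex general_hexagon_side[OF hexagon that(3,4)] in \<open>auto simp: proj_subspace_def\<close>)
  have mem: "a1 \<in> V {i}" "a1 \<in> V {i, j}" "a2 \<in> V {j}" "a2 \<in> V {i, j}" "a3 \<in> V {j}" "a3 \<in> V {j, k}"
    "a4 \<in> V {k}" "a4 \<in> V {j, k}" "a5 \<in> V {k}" "a5 \<in> V {i, k}" "a6 \<in> V {i}" "a6 \<in> V {i, k}"
    using generator_in_line[of j "{i}"] generator_in_line[of i "{j}"] generator_in_line[of k "{j}"]
      generator_in_line[of j "{k}"] generator_in_line[of i "{k}"] generator_in_line[of k "{i}"] directions_neq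
    by (auto simp: insert_commute)
  show "V {i} = vec.span {a6, a1}" "V {i, j} = vec.span {a1, a2}" "V {j} = vec.span {a2, a3}"
    "V {j, k} = vec.span {a3, a4}" "V {k} = vec.span {a4, a5}" "V {i, k} = vec.span {a5, a6}"
    by (rule side; use hexagon_distinct mem in auto)+
qed

lemma proper_vertices: "S \<noteq> {} \<and> S \<noteq> UNIV \<longleftrightarrow> S \<in> {{i}, {j}, {k}, {j, k}, {i, k}, {i, j}}"
proof
  assume S: "S \<noteq> {} \<and> S \<noteq> UNIV"
  have "S \<in> Pow {i, j, k}" using UNIV_directions by (metis PowI subset_UNIV)
  then have "S = {} \<or> S = {i, j, k} \<or> S \<in> {{i}, {j}, {k}, {j, k}, {i, k}, {i, j}}"
    by (auto simp: Pow_insert)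
  then show "S \<in> {{i}, {j}, {k}, {j, k}, {i, k}, {i, j}}" using S UNIV_directions by metis
next
  assume S: "S \<in> {{i}, {j}, {k}, {j, k}, {i, k}, {i, j}}"
  then have "S \<noteq> {i, j, k}" using directions_neq by auto
  then show "S \<noteq> {} \<and> S \<noteq> UNIV" using S UNIV_directions by auto
qed

lemma opposite_sides_conjugate_iff:
  "(\<forall>S. S \<noteq> {} \<and> S \<noteq> UNIV \<longrightarrow> (\<forall>x\<in>V S. \<forall>y\<in>V (- S). corr_form B y x = 0))
     \<longleftrightarrow> conjugate_nonadjacent B a1 a2 a3 a4 a5 a6"
proof -
  have "(\<forall>S. S \<noteq> {} \<and> S \<noteq> UNIV \<longrightarrow> (\<forall>x\<in>V S. \<forall>y\<in>V (- S). corr_form B y x = 0)) \<longleftrightarrow>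
    (\<forall>S\<in>{{i}, {j}, {k}, {j, k}, {i, k}, {i, j}}. \<forall>x\<in>V S. \<forall>y\<in>V (- S). corr_form B y x = 0)"
    unfolding proper_vertices by blast
  also have "\<dots> \<longleftrightarrow> conjugate_nonadjacent B a1 a2 a3 a4 a5 a6" (is "?L \<longleftrightarrow> ?R")
  proof
    have orth: "(\<forall>x\<in>vec.span {u, v}. \<forall>y\<in>vec.span {w, z}. corr_form B y x = 0) \<longleftrightarrow>
       corr_form B w u = 0 \<and> corr_form B w v = 0 \<and> corr_form B z u = 0 \<and> corr_form B z v = 0" for u v w z
    proof
      assume "\<forall>x\<in>vec.span {u, v}. \<forall>y\<in>vec.span {w, z}. corr_form B y x = 0"
      then show "corr_form B w u = 0 \<and> corr_form B w v = 0 \<and> corr_form B z u = 0 \<and> corr_form B z v = 0"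
        by (simp add: vec.span_base)
    qed (auto simp: span2_iff)
    show "?L \<Longrightarrow> ?R"
      by (simp add: complements hexagon_sides orth conjugate_nonadjacent_def)
    show "?R \<Longrightarrow> ?L"
      by (simp add: complements hexagon_sides orth conjugate_nonadjacent_def)
  qed
  finally show ?thesis .
qed

text \<open>
  The line at \<open>{}\<close> is the transversal of the sides at \<open>{i}\<close>, \<open>{j}\<close>, \<open>{k}\<close>. Three of the four
  edge points in direction \<open>i\<close>, given by \<open>x\<close>, \<open>a2\<close> and \<open>a5\<close>, always span a plane, so that coplanarity means
  that the fourth lies in this plane.
\<close>

lemma coplanar_iff_conjugate:
  assumes inv: "invertible B" and conj: "conjugate_nonadjacent B a1 a2 a3 a4 a5 a6"
  shows "proj_coplanar {edge_point l n ({}, i), edge_point l n ({j}, i), edge_point l n ({j, k}, i), edge_point l n ({k}, i)}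
    \<longleftrightarrow> (\<forall>x\<in>V {}. corr_form B (a ({j, k}, i)) x = 0)"
proof -
  define x y where "x = a ({}, i)" and "y = a ({j, k}, i)"
  have mem: "x \<in> V {}" "x \<in> V {i}" "a ({}, j) \<in> V {}" "a ({}, j) \<in> V {j}"
    "a ({}, k) \<in> V {}" "a ({}, k) \<in> V {k}" "y \<in> V {j, k}"
    using directions_neq by (auto simp: x_def y_def intro: generator_in_line simp del: cube_vertex_empty)
  have dim: "vec.dim {x, a2, a5} = 3"
  proof -
    have "x \<notin> vec.span {a2, a5}"
      using general_hexagon_skew[OF hexagon, of a6 a1 a2 a5 x] mem(2) hexagon_sides(1) hexagon_distinct
        generator_nonzero[of i "{}"] by (auto simp: x_def)
    moreover have "vec.dim {a2, a5} = 2"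
      using general_hexagon_side[OF hexagon, of a2 a5] hexagon_distinct by (simp add: proj_subspace_def)
    ultimately show ?thesis by (simp add: vec.dim_insert)
  qed
  have "proj_coplanar {vec.span {x}, vec.span {a2}, vec.span {y}, vec.span {a5}} \<longleftrightarrow> y \<in> vec.span {x, a2, a5}"
  proof
    assume "proj_coplanar {vec.span {x}, vec.span {a2}, vec.span {y}, vec.span {a5}}"
    then obtain E where E: "proj_plane E" "x \<in> E" "a2 \<in> E" "y \<in> E" "a5 \<in> E"
      unfolding proj_coplanar_def using vec.span_base by blast
    have "vec.span {x, a2, a5} = E"
      using E dim by (intro vec.subspace_dim_equal vec.span_minimal) (auto simp: proj_subspace_def)
    then show "y \<in> vec.span {x, a2, a5}" using E by simp
  next
    assume "y \<in> vec.span {x, a2, a5}"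
    then show "proj_coplanar {vec.span {x}, vec.span {a2}, vec.span {y}, vec.span {a5}}"
      unfolding proj_coplanar_def using dim
      by (intro exI[of _ "vec.span {x, a2, a5}"]) (simp add: proj_subspace_def vec.span_minimal vec.span_base)
  qed
  also have "\<dots> \<longleftrightarrow> (\<forall>x\<in>V {}. corr_form B y x = 0)"
    using mem hexagon_sides generator_nonzero[of _ "{}"] proj_line_complex
    by (intro transversal_conjugate_iff[OF hexagon inv conj, of "V {}" x "a ({}, j)" "a ({}, k)"])
      (auto simp: x_def)
  finally show ?thesis
    using generator directions_neq by (simp add: x_def y_def del: cube_vertex_empty)
qed

end

lemma (in labelled_cube) top_line: "V UNIV = vec.span {a ({j, k}, i), a ({i, k}, j)}"
proof (rule line_through[symmetric])
  have *: "insert i {j, k} = UNIV" "insert j {i, k} = UNIV" using UNIV_directions by auto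
  have "vec.span {a ({j, k}, i)} \<noteq> vec.span {a ({i, k}, j)}"
    using edge_points_distinct[where n = n, of UNIV "{j, k}" i "{i, k}" j] generator[of i "{j, k}"] generator[of j "{i, k}"]
      directions_neq * by (auto simp: edge_ends_def)
  then show "a ({i, k}, j) \<notin> vec.span {a ({j, k}, i)}"
    using span_singleton_swap generator_nonzero[of j "{i, k}"] directions_neq by auto
  show "a ({j, k}, i) \<in> V UNIV" "a ({i, k}, j) \<in> V UNIV"
    using generator_in_line(2)[of i "{j, k}"] generator_in_line(2)[of j "{i, k}"] directions_neq * by auto
qed (use generator_nonzero[of i "{j, k}"] directions_neq proj_line_complex in auto)

section \<open>Planarity and the interchange of opposite lines\<close>

context intersecting_complex
begin

abbreviation opposite_conjugate :: "complex^4^4 \<Rightarrow> int^3 \<Rightarrow> 3 set \<Rightarrow> bool" where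
  "opposite_conjugate B n S \<equiv>
     \<forall>x\<in>l (cube_vertex n S). \<forall>y\<in>l (cube_vertex n (- S)). corr_form B y x = 0"

definition planar_cube :: "int^3 \<Rightarrow> bool" where
  "planar_cube n \<longleftrightarrow> (\<forall>i j k. distinct [i, j, k] \<longrightarrow>
     proj_coplanar {meet_point l i n, meet_point l i (n + dir j),
                    meet_point l i (n + dir j + dir k), meet_point l i (n + dir k)})"

lemma interchanges_opposite_iff:
  "invertible B \<Longrightarrow> interchanges_opposite B l n \<longleftrightarrow> (\<forall>S. opposite_conjugate B n S)"
  by (simp add: interchanges_opposite_def correlation_image_eq_iff[OF _ proj_line_complex proj_line_complex])

lemma labelled_cube_exists:
  assumes "distinct [i, j, k]"
  obtains a where "labelled_cube l n i j k a"
proof -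
  obtain a where "\<And>S i. i \<notin> S \<Longrightarrow> a (S, i) \<noteq> 0"
    "\<And>S i. i \<notin> S \<Longrightarrow> edge_point l n (S, i) = vec.span {a (S, i)}"
    by (rule edge_generators[where n = n]) blast
  then have "labelled_cube l n i j k a"
    using assms by unfold_locales auto
  then show ?thesis using that by blast
qed

lemma symmetric_if_interchanges:
  assumes "invertible B" "interchanges_opposite B l n"
  shows "transpose B = B"
proof -
  obtain a where "labelled_cube l n 1 2 3 a" using labelled_cube_exists[of 1 2 3] by auto
  then interpret labelled_cube l n 1 2 3 a .
  have "\<forall>S. S \<noteq> {} \<and> S \<noteq> UNIV \<longrightarrow> opposite_conjugate B n S"
    using assms by (simp add: interchanges_opposite_iff)
  then have "conjugate_nonadjacent B a1 a2 a3 a4 a5 a6"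
    by (rule iffD1[OF opposite_sides_conjugate_iff])
  then show ?thesis by (rule conjugate_nonadjacent_symmetric[OF hexagon])
qed

lemma hexagon_polarity_exists:
  obtains B where "invertible B" "transpose B = B"
    "\<And>S. S \<noteq> {} \<Longrightarrow> S \<noteq> UNIV \<Longrightarrow> opposite_conjugate B n S"
proof -
  obtain a where "labelled_cube l n 1 2 3 a" using labelled_cube_exists[of 1 2 3] by auto
  then interpret labelled_cube l n 1 2 3 a .
  obtain B where B: "invertible B" "transpose B = B" "conjugate_nonadjacent B a1 a2 a3 a4 a5 a6"
    using polarity_of_hexagon[OF hexagon] .
  have "\<forall>S. S \<noteq> {} \<and> S \<noteq> UNIV \<longrightarrow> opposite_conjugate B n S"
    by (rule iffD2[OF opposite_sides_conjugate_iff B(3)])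
  then show ?thesis by (intro that[OF B(1,2)]) simp_all
qed

text \<open>
  The line at \<open>UNIV\<close> is spanned by any two of its three edge points. Therefore the three planarity
  conditions, each of which makes one of these points conjugate to the line at \<open>{}\<close>, amount to the
  conjugacy of the two lines.
\<close>

lemma planar_cube_iff:
  assumes inv: "invertible B" and conj: "\<And>S. S \<noteq> {} \<Longrightarrow> S \<noteq> UNIV \<Longrightarrow> opposite_conjugate B n S"
  shows "planar_cube n \<longleftrightarrow> opposite_conjugate B n {}"
proof -
  have key: "proj_coplanar {meet_point l i n, meet_point l i (n + dir j),
      meet_point l i (n + dir j + dir k), meet_point l i (n + dir k)}
    \<longleftrightarrow> (\<forall>x\<in>l n. corr_form B (a ({j, k}, i)) x = 0)"
    if cube: "labelled_cube l n i j k a" for i j k a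
  proof -
    interpret labelled_cube l n i j k a by (rule cube)
    have "\<forall>S. S \<noteq> {} \<and> S \<noteq> UNIV \<longrightarrow> opposite_conjugate B n S"
      by (intro allI impI; elim conjE; rule conj)
    then have "conjugate_nonadjacent B a1 a2 a3 a4 a5 a6"
      by (rule iffD1[OF opposite_sides_conjugate_iff])
    moreover have "cube_vertex n {j, k} = n + dir j + dir k" "cube_vertex n {m} = n + dir m" for m
      using directions_neq cube_vertex_insert[of j "{k}" n] cube_vertex_insert[of _ "{}" n]
      by (auto simp: ac_simps)
    ultimately show ?thesis
      using coplanar_iff_conjugate[OF inv] by (simp add: edge_point_def)
  qed
  show ?thesis
  proof
    assume planar: "planar_cube n"
    obtain a where cube: "labelled_cube l n 1 2 3 a" using labelled_cube_exists[of 1 2 3] by auto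
    then interpret labelled_cube l n 1 2 3 a .
    \<comment> \<open>The same generators, relabelled so that direction 2 takes the place of \<open>i\<close>.\<close>
    have "labelled_cube l n 2 1 3 a"
      using generator generator_nonzero by unfold_locales auto
    then have "\<forall>x\<in>l n. corr_form B (a ({2, 3}, 1)) x = 0" "\<forall>x\<in>l n. corr_form B (a ({1, 3}, 2)) x = 0"
      using key[OF cube] key[of 2 1 3 a] planar unfolding planar_cube_def by auto
    then show "opposite_conjugate B n {}"
      using top_line by (auto simp: span2_iff)
  next
    assume opp: "opposite_conjugate B n {}"
    show "planar_cube n"
      unfolding planar_cube_def
    proof (intro allI impI)
      fix i j k :: 3 assume "distinct [i, j, k]"
      then obtain a where cube: "labelled_cube l n i j k a" using labelled_cube_exists by blast
      then interpret labelled_cube l n i j k a .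
      have "a ({j, k}, i) \<in> V UNIV" by (simp add: top_line vec.span_base)
      then show "proj_coplanar {meet_point l i n, meet_point l i (n + dir j),
          meet_point l i (n + dir j + dir k), meet_point l i (n + dir k)}"
        using key[OF cube] opp by simp
    qed
  qed
qed

text \<open>
  The polarity of the hexagon interchanges three of the four pairs of opposite lines in any case, and
  planarity is what makes it interchange the fourth.
\<close>

lemma planar_cube_iff_interchanges:
  "planar_cube n \<longleftrightarrow> (\<exists>B. correlation B \<and> interchanges_opposite B l n)"
proof
  assume planar: "planar_cube n"
  obtain B where B: "invertible B" "transpose B = B"
    "\<And>S. S \<noteq> {} \<Longrightarrow> S \<noteq> UNIV \<Longrightarrow> opposite_conjugate B n S"
    by (rule hexagon_polarity_exists[where n = n]) blast
  have "opposite_conjugate B n {}" using planar_cube_iff[OF B(1,3)] planar by blast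
  moreover from this have "opposite_conjugate B n UNIV"
    using B(2) unfolding symmetric_iff_corr_form by (metis Compl_UNIV_eq Compl_empty_eq)
  ultimately have "opposite_conjugate B n S" for S using B(3) by metis
  then show "\<exists>B. correlation B \<and> interchanges_opposite B l n"
    using B(1) interchanges_opposite_iff unfolding correlation_def by blast
next
  assume "\<exists>B. correlation B \<and> interchanges_opposite B l n"
  then show "planar_cube n"
    using planar_cube_iff interchanges_opposite_iff unfolding correlation_def by blast
qed

section \<open>Diagonals\<close>

text \<open>
  The ends of a diagonal are distinct: a common point of two parallel edges of a face would lie on all four
  lines of this face, and then two edges at a vertex would have the same point.
\<close>

lemma proj_line_diagonal:
  assumes "i \<noteq> j" "i \<notin> S" "j \<notin> S"
  shows "proj_line (proj_join (edge_point l n (S, i)) (edge_point l n (insert j S, i)))"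
proof -
  obtain a where nz: "\<And>S i. i \<notin> S \<Longrightarrow> a (S, i) \<noteq> 0"
    and a: "\<And>S i. i \<notin> S \<Longrightarrow> edge_point l n (S, i) = vec.span {a (S, i)}"
    by (rule edge_generators[where n = n]) blast
  have "edge_point l n (S, i) \<noteq> edge_point l n (insert j S, i)"
  proof
    assume eq: "edge_point l n (S, i) = edge_point l n (insert j S, i)"
    have "edge_point l n (S, i) \<subseteq> edge_point l n (S, j)"
      using eq assms edge_point_eq[of i S l n] edge_point_eq[of i "insert j S" l n] edge_point_eq[of j S l n] by blast
    then have "a (S, i) \<in> vec.span {a (S, j)}"
      using a assms vec.span_base by blast
    then have "edge_point l n (S, i) = edge_point l n (S, j)"
      using a nz assms span_singleton_swap by metis
    then show False
      using edge_points_distinct[where n = n, of S S i S j] assms by (auto simp: edge_ends_def)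
  qed
  then have "a (insert j S, i) \<notin> vec.span {a (S, i)}"
    using a nz assms span_singleton_swap by (metis insert_iff)
  then have "proj_line (vec.span {a (S, i), a (insert j S, i)})"
    using nz assms by (intro proj_line_span) auto
  then show ?thesis
    using a assms by (simp add: proj_join_span)
qed

lemma diagonal_eq:
  assumes "i \<noteq> j" "i \<notin> S" "j \<notin> S"
  shows "diagonal l i j (cube_vertex n S) = proj_join (edge_point l n (S, i)) (edge_point l n (insert j S, i))"
  using assms by (simp add: diagonal_def edge_point_def cube_vertex_insert)

text \<open>
  Each end of the first diagonal is conjugate to each end of the second, because the two points lie on
  lines attached to opposite vertices of the cube. Since the diagonals are lines, one is the image of
  the other.
\<close>

lemma correlation_image_diagonal:
  assumes inv: "invertible B" and int: "interchanges_opposite B l n"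
  and ij: "i \<noteq> j" "i \<notin> S" "j \<notin> S" and T: "T = - insert i (insert j S)"
  shows "correlation_image B (diagonal l i j (cube_vertex n S)) = diagonal l j i (cube_vertex n T)"
proof -
  have T': "i \<notin> T" "j \<notin> T" by (auto simp: T)
  note lines = proj_line_diagonal[OF ij] proj_line_diagonal[OF ij(1)[symmetric] T'(2,1)]
  have opp: "corr_form B y x = 0" if "x \<in> l (cube_vertex n R)" "y \<in> l (cube_vertex n R')" "R' = - R" for x y R R'
    using int that unfolding interchanges_opposite_iff[OF inv] by blast
  obtain a where a: "\<And>S i. i \<notin> S \<Longrightarrow> edge_point l n (S, i) = vec.span {a (S, i)}"
    by (rule edge_generators[where n = n]) blast
  have mem: "a (R, m) \<in> l (cube_vertex n R)" "a (R, m) \<in> l (cube_vertex n (insert m R))" if "m \<notin> R" for R m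
    using a[OF that] edge_point_eq[OF that, of l n] vec.span_base[of "a (R, m)" "{a (R, m)}"] by auto
  have "corr_form B (a (T, j)) (a (S, i)) = 0"
    by (rule opp[of _ "insert i S" _ "insert j T"]) (use ij T' mem in \<open>auto simp: T\<close>)
  moreover have "corr_form B (a (insert i T, j)) (a (S, i)) = 0"
    by (rule opp[of _ S _ "insert j (insert i T)"]) (use ij T' mem in \<open>auto simp: T\<close>)
  moreover have "corr_form B (a (T, j)) (a (insert j S, i)) = 0"
    by (rule opp[of _ "insert i (insert j S)" _ T]) (use ij T' mem in \<open>auto simp: T\<close>)
  moreover have "corr_form B (a (insert i T, j)) (a (insert j S, i)) = 0"
    by (rule opp[of _ "insert j S" _ "insert i T"]) (use ij T' mem in \<open>auto simp: T\<close>)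
  moreover have "proj_line (vec.span {a (S, i), a (insert j S, i)})"
    "proj_line (vec.span {a (T, j), a (insert i T, j)})"
    using lines[where n = n] ij T' by (simp_all add: a proj_join_span)
  ultimately have "correlation_image B (vec.span {a (S, i), a (insert j S, i)})
      = vec.span {a (T, j), a (insert i T, j)}"
    by (subst correlation_image_eq_iff[OF inv]) (auto simp: span2_iff)
  then show ?thesis
    using ij T' by (simp add: diagonal_eq a proj_join_span)
qed

abbreviation coplanar_quadruple where
  "coplanar_quadruple n i j k \<equiv>
     {diagonal l i j n, diagonal l i j (n + dir k), diagonal l i k n, diagonal l i k (n + dir j)}"

abbreviation concurrent_quadruple where
  "concurrent_quadruple n i j k \<equiv>
     {diagonal l i j n, diagonal l i j (n + dir k), diagonal l k j n, diagonal l k j (n + dir i)}"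

lemma quadruples_interchanged:
  assumes inv: "invertible B" and int: "interchanges_opposite B l n" and dist: "distinct [i, j, k]"
  shows "correlation_image B ` coplanar_quadruple n j i k = concurrent_quadruple n i j k"
    "correlation_image B ` concurrent_quadruple n i j k = coplanar_quadruple n j i k"
proof -
  have *: "correlation_image B (diagonal l p q n) = diagonal l q p (n + dir r)"
    "correlation_image B (diagonal l p q (n + dir r)) = diagonal l q p n"
    if d: "distinct [p, q, r]" for p q r
  proof -
    have "- {p, q} = {r}" "- {p, q, r} = {}"
      using d UNIV_3_eq[OF d] by (auto simp: Compl_eq_Diff_UNIV)
    moreover have "cube_vertex n {r} = n + dir r" using cube_vertex_insert[of r "{}" n] by simp
    ultimately show "correlation_image B (diagonal l p q n) = diagonal l q p (n + dir r)"
      "correlation_image B (diagonal l p q (n + dir r)) = diagonal l q p n"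
      using correlation_image_diagonal[OF inv int, of p q "{}" "{r}"]
        correlation_image_diagonal[OF inv int, of p q "{r}" "{}"] d by auto
  qed
  have d: "distinct [j, i, k]" "distinct [j, k, i]" "distinct [k, j, i]" using dist by auto
  show "correlation_image B ` coplanar_quadruple n j i k = concurrent_quadruple n i j k"
    by (simp add: *[OF d(1)] *[OF d(2)] insert_commute)
  show "correlation_image B ` concurrent_quadruple n i j k = coplanar_quadruple n j i k"
    by (simp add: *[OF dist] *[OF d(3)] insert_commute)
qed

lemma coplanar_quadruple_coplanar:
  assumes "planar_cube n" "distinct [i, j, k]"
  shows "proj_coplanar (coplanar_quadruple n i j k)"
proof -
  have "proj_coplanar {meet_point l i n, meet_point l i (n + dir j),
                       meet_point l i (n + dir j + dir k), meet_point l i (n + dir k)}"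
    using assms by (simp add: planar_cube_def)
  then obtain E where E: "proj_plane E" "meet_point l i n \<subseteq> E" "meet_point l i (n + dir j) \<subseteq> E"
      "meet_point l i (n + dir j + dir k) \<subseteq> E" "meet_point l i (n + dir k) \<subseteq> E"
    by (auto simp: proj_coplanar_def)
  then have "proj_join P Q \<subseteq> E" if "P \<subseteq> E" "Q \<subseteq> E" for P Q
    using that by (simp add: proj_join_def proj_subspace_def vec.span_minimal)
  then show ?thesis
    using E unfolding proj_coplanar_def diagonal_def
    by (intro exI[of _ E]) (simp add: add.assoc add.commute add.left_commute)
qed

text \<open>
  The lines pass through the image of the plane that contains \<open>\<L>\<close>.
\<close>

lemma concurrent_if_correlation_image:
  assumes "invertible B" "proj_coplanar \<L>"
  shows "proj_concurrent (correlation_image B ` \<L>)"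
proof -
  obtain E where E: "proj_plane E" "\<And>L. L \<in> \<L> \<Longrightarrow> L \<subseteq> E"
    using assms(2) by (auto simp: proj_coplanar_def)
  have "proj_point (correlation_image B E)"
    using dim_correlation_image[OF assms(1), of E] E(1) subspace_correlation_image
    by (simp add: proj_subspace_def)
  moreover have "\<forall>L\<in>correlation_image B ` \<L>. correlation_image B E \<subseteq> L"
    using E(2) by (simp add: correlation_image_antimono)
  ultimately show ?thesis
    unfolding proj_concurrent_def by (intro exI conjI)
qed

end

section \<open>Fundamental line complexes\<close>

theorem theorem5p2:
  fixes l :: "int^3 \<Rightarrow> (complex^4) set"
  assumes "line_complex l" and "general_position l"
  shows
    "(fundamental l \<longleftrightarrow>
        neighbours_intersect l \<and> (\<forall>n. \<exists>B. correlation B \<and> interchanges_opposite B l n)) \<and>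
     (neighbours_intersect l \<longrightarrow>
        (\<forall>n B. correlation B \<and> interchanges_opposite B l n \<longrightarrow> polarity B)) \<and>
     (fundamental l \<longrightarrow>
        (\<forall>n B. correlation B \<and> interchanges_opposite B l n \<longrightarrow>
           (\<forall>Q\<in>coplanar_quadruples l n.
              proj_coplanar Q \<and> correlation_image B ` Q \<in> concurrent_quadruples l n) \<and>
           (\<forall>Q\<in>concurrent_quadruples l n.
              proj_concurrent Q \<and> correlation_image B ` Q \<in> coplanar_quadruples l n)))"
proof (cases "neighbours_intersect l")
  case False
  then show ?thesis by (simp add: fundamental_def)
next
  case True
  interpret intersecting_complex l using assms True by unfold_locales
  have fundamental: "fundamental l \<longleftrightarrow> (\<forall>n. planar_cube n)"
    by (simp only: True fundamental_def planar_cube_def simp_thms)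
  have quadruples: "(\<forall>Q\<in>coplanar_quadruples l n.
          proj_coplanar Q \<and> correlation_image B ` Q \<in> concurrent_quadruples l n) \<and>
       (\<forall>Q\<in>concurrent_quadruples l n.
          proj_concurrent Q \<and> correlation_image B ` Q \<in> coplanar_quadruples l n)"
    if "fundamental l" and B: "invertible B" "interchanges_opposite B l n" for n B
  proof -
    have cop: "proj_coplanar (coplanar_quadruple n i j k)" if "distinct [i, j, k]" for i j k
      using coplanar_quadruple_coplanar \<open>fundamental l\<close> fundamental that by blast
    have concI: "concurrent_quadruple n i j k \<in> concurrent_quadruples l n"
      and copI: "coplanar_quadruple n i j k \<in> coplanar_quadruples l n" if "distinct [i, j, k]" for i j k
      unfolding concurrent_quadruples_def coplanar_quadruples_def using that by fast+
    show ?thesis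
    proof (intro conjI ballI)
      fix Q assume "Q \<in> coplanar_quadruples l n"
      then obtain i j k where Q: "Q = coplanar_quadruple n i j k" and d: "distinct [i, j, k]"
        unfolding coplanar_quadruples_def by fast
      have d': "distinct [j, i, k]" using d by auto
      show "proj_coplanar Q" unfolding Q by (rule cop[OF d])
      show "correlation_image B ` Q \<in> concurrent_quadruples l n"
        unfolding Q quadruples_interchanged(1)[OF B d'] by (rule concI[OF d'])
    next
      fix Q assume "Q \<in> concurrent_quadruples l n"
      then obtain i j k where Q: "Q = concurrent_quadruple n i j k" and d: "distinct [i, j, k]"
        unfolding concurrent_quadruples_def by fast
      have d': "distinct [j, i, k]" using d by auto
      show "proj_concurrent Q"
        unfolding Q quadruples_interchanged(1)[OF B d, symmetric]
        by (rule concurrent_if_correlation_image[OF B(1) cop[OF d']])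
      show "correlation_image B ` Q \<in> coplanar_quadruples l n"
        unfolding Q quadruples_interchanged(2)[OF B d] by (rule copI[OF d'])
    qed
  qed
  have polarity: "polarity B" if "correlation B" "interchanges_opposite B l n" for n B
    using that symmetric_if_interchanges by (simp add: polarity_def correlation_def)
  show ?thesis
  proof (intro conjI[OF _ conjI] impI allI)
    show "fundamental l \<longleftrightarrow>
        neighbours_intersect l \<and> (\<forall>n. \<exists>B. correlation B \<and> interchanges_opposite B l n)"
      using True fundamental planar_cube_iff_interchanges by simp
  qed (elim conjE, rule polarity, assumption, assumption,
      elim conjE, rule quadruples, simp_all add: correlation_def)
qed

end
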